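(* Fix positive integers $n$ and $N$, and let $A_1,\dots,A_N$ be real numbers with $-(n+1)\le A_j\le n(n+1)$ for all $j\in\{1,\dots,N\}$. Let $$h(x)=x(x-1\cdot 2)(x-2\cdot 3)\cdots\big(x-(n-1)n\big)\prod_{j=1}^{N}(x-A_j).$$ Then $\{h(k^2+k)\}_{k=0}^{\infty}$ is a multiplier sequence for the Legendre basis.
   Context: For each nonnegative integer $k$, $P_k$ denotes the $k$-th Legendre polynomial: the polynomial solution of $(x^2-1)y''+2xy'-k(k+1)y=0$ normalized by $P_k(1)=1$. A polynomial in $\mathbb{R}[x]$ is called hyperbolic if all of its zeros are real; by convention the zero polynomial is hyperbolic (and so are nonzero constants). An operator on $\mathbb{R}[x]$ is a hyperbolicity preserver if it maps every hyperbolic polynomial to a hyperbolic polynomial. A real sequence $\{\gamma_k\}_{k=0}^{\infty}$ is a multiplier sequence for the Legendre basis if the linear operator $T$ on $\mathbb{R}[x]$ defined by $T[P_k]=\gamma_kP_k$ for all $k\ge 0$ is a hyperbolicity preserver. The factors of $h$ preceding $\prod_{j=1}^N$ are $x-i(i+1)$ for $i=0,1,\dots,n-1$. *)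

theory Defs
  imports "HOL-Analysis.Analysis" "HOL-Computational_Algebra.Polynomial"
begin

text \<open>
  The zeros of a real polynomial are its complex zeros. The zero polynomial counts as hyperbolic
  by convention; nonzero constants are hyperbolic vacuously.
\<close>

definition hyperbolic :: "real poly \<Rightarrow> bool" where
  "hyperbolic p \<longleftrightarrow> p = 0 \<or> (\<forall>z::complex. poly (map_poly of_real p) z = 0 \<longrightarrow> z \<in> \<real>)"

definition hyperbolicity_preserver :: "(real poly \<Rightarrow> real poly) \<Rightarrow> bool" where
  "hyperbolicity_preserver T \<longleftrightarrow> (\<forall>p. hyperbolic p \<longrightarrow> hyperbolic (T p))"

definition is_legendre :: "nat \<Rightarrow> real poly \<Rightarrow> bool" where
  "is_legendre k y \<longleftrightarrow>
     [:-1, 0, 1:] * pderiv (pderiv y) + [:0, 2:] * pderiv y - smult (of_nat k * (of_nat k + 1)) y = 0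
     \<and> poly y 1 = 1"

definition legendre :: "nat \<Rightarrow> real poly" where
  "legendre k = (THE y. is_legendre k y)"

text \<open>
  The linear operator with \<open>T (legendre k) = smult (\<gamma> k) (legendre k)\<close> exists and is unique
  because the Legendre polynomials form a basis (there is one of each degree), so the existential
  quantifier below merely names it; see \<open>legendre_operator_unique\<close> for uniqueness.
\<close>

definition legendre_multiplier_sequence :: "(nat \<Rightarrow> real) \<Rightarrow> bool" where
  "legendre_multiplier_sequence \<gamma> \<longleftrightarrow>
     (\<exists>T. Vector_Spaces.linear smult smult T
          \<and> (\<forall>k. T (legendre k) = smult (\<gamma> k) (legendre k))
          \<and> hyperbolicity_preserver T)"


text \<open>The definite description in \<open>legendre\<close> is well defined, and the degree is as expected.\<close>

lemma is_legendre_pcompose_iff: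
  "is_legendre k (pcompose q [:-1, 1:]) \<longleftrightarrow>
     coeff q 0 = 1 \<and>
     (\<forall>m. 2 * (of_nat m + 1)^2 * coeff q (Suc m) =
          (of_nat k * (of_nat k + 1) - of_nat m * (of_nat m + 1)) * coeff q m)"
proof -
  let ?l = "[:-1, 1:] :: real poly"
  define r where "r = [:0, 2, 1:] * pderiv (pderiv q) + [:2, 2:] * pderiv q
                      - smult (of_nat k * (of_nat k + 1)) q"
  have d: "pderiv (pcompose p ?l) = pcompose (pderiv p) ?l" for p
    by (simp add: pderiv_pcompose pderiv_pCons)
  have a: "[:-1, 0, 1:] = pcompose [:0, 2, 1:] ?l" "[:0, 2:] = pcompose [:2, 2:] ?l"
    by (simp_all add: pcompose_pCons)
  have "[:-1, 0, 1:] * pderiv (pderiv (pcompose q ?l)) + [:0, 2:] * pderiv (pcompose q ?l)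
          - smult (of_nat k * (of_nat k + 1)) (pcompose q ?l) = pcompose r ?l"
    unfolding r_def d a by (simp only: pcompose_add pcompose_diff pcompose_mult pcompose_smult)
  moreover have "pcompose r ?l = 0 \<longleftrightarrow> r = 0"
    by (rule pcompose_eq_0_iff) simp
  moreover have "coeff r m = 2 * (of_nat m + 1)^2 * coeff q (Suc m)
      - (of_nat k * (of_nat k + 1) - of_nat m * (of_nat m + 1)) * coeff q m" for m
    unfolding r_def
    by (cases m; cases "m - 1")
       (auto simp: coeff_pCons coeff_pderiv power2_eq_square algebra_simps split: nat.splits)
  then have "r = 0 \<longleftrightarrow> (\<forall>m. 2 * (of_nat m + 1)^2 * coeff q (Suc m) =
          (of_nat k * (of_nat k + 1) - of_nat m * (of_nat m + 1)) * coeff q m)"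
    by (simp add: poly_eq_iff)
  moreover have "poly (pcompose q ?l) 1 = coeff q 0"
    by (simp add: poly_pcompose poly_0_coeff_0)
  ultimately show ?thesis
    unfolding is_legendre_def by auto
qed

lemma is_legendre_ex: "\<exists>y. is_legendre k y \<and> degree y = k"
proof -
  define a :: "nat \<Rightarrow> real" where
    "a m = (\<Prod>i<m. (of_nat k * (of_nat k + 1) - of_nat i * (of_nat i + 1)) / (2 * (of_nat i + 1)^2))" for m
  have mono: "i < k \<Longrightarrow> of_nat i * (of_nat i + 1) < of_nat k * (of_nat k + (1::real))" for i
    by (intro mult_strict_mono) auto
  have a0: "a m = 0" if "m > k" for m
    using that unfolding a_def by (auto intro!: prod_zero)
  have ak: "a k \<noteq> 0"
    unfolding a_def by (auto simp: add_nonneg_eq_0_iff dest: mono)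
  define q where "q = Poly (map a [0..<Suc k])"
  have cq: "coeff q m = a m" for m
    using a0 unfolding q_def by (auto simp: nth_default_def simp del: upt_Suc)
  have dq: "degree q = k"
    using a0 ak by (intro antisym degree_le le_degree) (auto simp: cq)
  have s: "2 * (of_nat m + 1)^2 * a (Suc m) =
          (of_nat k * (of_nat k + 1) - of_nat m * (of_nat m + 1)) * a m" for m
  proof -
    have "of_nat m + 1 \<noteq> (0::real)" by (simp add: add_nonneg_eq_0_iff)
    then show ?thesis unfolding a_def by (simp add: field_simps)
  qed
  have "is_legendre k (pcompose q [:-1, 1:])"
    unfolding is_legendre_pcompose_iff cq using s by (simp add: a_def)
  moreover have "degree (pcompose q [:-1, 1:]) = k"
    by (simp add: degree_pcompose dq)
  ultimately show ?thesis by blast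
qed

lemma is_legendre_unique:
  assumes "is_legendre k y" "is_legendre k z"
  shows "y = z"
proof -
  have shift: "pcompose (pcompose p [:1, 1:]) [:-1, 1:] = p" for p :: "real poly"
    by (simp add: pcompose_assoc[symmetric] pcompose_pCons)
  define u where "u = pcompose y [:1, 1:]"
  define v where "v = pcompose z [:1, 1:]"
  have "is_legendre k (pcompose u [:-1, 1:])" "is_legendre k (pcompose v [:-1, 1:])"
    using assms by (simp_all only: u_def v_def shift)
  then have uv: "coeff u 0 = 1" "coeff v 0 = 1"
    and u: "\<And>m. 2 * (of_nat m + 1)^2 * coeff u (Suc m) =
          (of_nat k * (of_nat k + 1) - of_nat m * (of_nat m + 1)) * coeff u m"
    and v: "\<And>m. 2 * (of_nat m + 1)^2 * coeff v (Suc m) =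
          (of_nat k * (of_nat k + 1) - of_nat m * (of_nat m + 1)) * coeff v m"
    by (auto simp only: is_legendre_pcompose_iff)
  have "coeff u m = coeff v m" for m
  proof (induction m)
    case (Suc m)
    have "2 * (of_nat m + 1)^2 * coeff u (Suc m) = 2 * (of_nat m + 1)^2 * coeff v (Suc m)"
      using u[of m] v[of m] Suc by simp
    moreover have "2 * (of_nat m + 1)^2 \<noteq> (0::real)" by (simp add: add_nonneg_eq_0_iff)
    ultimately show ?case by (metis mult_cancel_left)
  qed (use uv in simp)
  then have "u = v" by (simp add: poly_eq_iff)
  then show ?thesis by (metis u_def v_def shift)
qed

lemma is_legendre_legendre: "is_legendre k (legendre k)"
  unfolding legendre_def using is_legendre_ex is_legendre_unique by (metis theI)

lemma degree_legendre: "degree (legendre k) = k"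
  using is_legendre_ex is_legendre_legendre is_legendre_unique by metis

lemma legendre_operator_unique:
  assumes "Vector_Spaces.linear smult smult S" "Vector_Spaces.linear smult smult T"
    and "\<And>k. S (legendre k) = smult (\<gamma> k) (legendre k)"
    and "\<And>k. T (legendre k) = smult (\<gamma> k) (legendre k)"
  shows "S = T"
proof
  interpret S: Vector_Spaces.linear smult smult S by fact
  interpret T: Vector_Spaces.linear smult smult T by fact
  fix p :: "real poly"
  show "S p = T p"
  proof (induction "degree p" arbitrary: p rule: less_induct)
    case less
    define c where "c = lead_coeff p / lead_coeff (legendre (degree p))"
    define r where "r = p - smult c (legendre (degree p))"
    have nz: "legendre (degree p) \<noteq> 0"
      using is_legendre_legendre[of "degree p"] by (auto simp: is_legendre_def)
    have p: "p = smult c (legendre (degree p)) + r" by (simp add: r_def)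
    have "S r = T r"
    proof (cases "r = 0")
      case False
      have "coeff r (degree p) = 0"
        using nz by (simp add: r_def c_def degree_legendre leading_coeff_0_iff[symmetric]
            del: leading_coeff_0_iff)
      moreover have "degree r \<le> degree p"
        unfolding r_def by (intro degree_diff_le degree_smult_le[THEN order_trans]) 
           (auto simp: degree_legendre)
      ultimately have "degree r < degree p"
        using False by (metis le_neq_implies_less leading_coeff_0_iff)
      then show ?thesis by (rule less)
    qed (simp add: S.zero T.zero)
    then show ?case
      by (subst (1 2) p) (simp only: S.add S.scale T.add T.scale assms(3,4))
  qed
qed

end

theory Submission
  imports Defs "HOL-Computational_Algebra.Fundamental_Theorem_Algebra"
begin

text \<open>
  Write \<open>D\<close> for differentiation and \<open>L = (x\<^sup>2 - 1) D\<^sup>2 + 2 x D\<close>, so that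
  \<open>L P\<^sub>k = k (k + 1) P\<^sub>k\<close>. The product of the \<open>L - i (i + 1)\<close> with \<open>i < n\<close> is
  \<open>D\<^sup>n (x\<^sup>2 - 1)\<^sup>n D\<^sup>n\<close>, and \<open>D\<^sup>n (L - A) = M D\<^sup>n\<close> for
  \<open>M = (x\<^sup>2 - 1) D\<^sup>2 + 2 (n + 1) x D + c\<close> with \<open>c = n (n + 1) - A\<close>. Hence the operator in question is
  \<open>D\<^sup>n (x\<^sup>2 - 1)\<^sup>n M\<^sub>1 \<dots> M\<^sub>N D\<^sup>n\<close>. Differentiation and multiplication by
  \<open>x\<^sup>2 - 1\<close> preserve hyperbolicity, and so does \<open>M\<close> if \<open>0 \<le> c \<le> (n + 1)\<^sup>2\<close>, which is the
  assumption on \<open>A\<close>. For the latter, freeze the coefficients of \<open>M\<close> at a point \<open>z\<close> of the upper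
  half-plane and replace the two factors \<open>D\<close> one after the other by means of the Lieb--Sokal lemma:
  if \<open>Q\<close> has no zeros in the upper half-plane, then \<open>Q' / Q\<close> has negative imaginary part there.
\<close>

section \<open>Logarithmic derivatives in the upper half-plane\<close>

lemma Im_inverse_neg:
  assumes "Im z > 0"
  shows "Im (1 / z) < 0"
  using assms by (auto simp: Im_divide divide_simps sum_power2_gt_zero_iff power2_eq_square
    zero_less_mult_iff add_pos_nonneg add_nonneg_pos)

text \<open>The logarithmic derivative is the sum of \<open>1 / (z - r)\<close> over the zeros
  \<open>r\<close>, and every \<open>z - r\<close> lies in the upper half-plane. The induction
  splits off one zero at a time.\<close>

lemma Im_logderiv_neg:
  fixes p :: "complex poly"
  assumes "degree p > 0" and "\<And>z. poly p z = 0 \<Longrightarrow> Im z \<le> 0" and "Im z > 0"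
  shows "Im (poly (pderiv p) z / poly p z) < 0"
  using assms(1,2)
proof (induction "degree p" arbitrary: p)
  case (Suc d)
  have "\<not> constant (poly p)" using Suc(2) by (simp add: constant_degree)
  then obtain r where r: "poly p r = 0" using fundamental_theorem_of_algebra by blast
  then obtain q where pq: "p = [:-r, 1:] * q" by (metis dvdE poly_eq_0_iff_dvd)
  have q0: "q \<noteq> 0" using Suc.prems(1) pq by auto
  then have dq: "d = degree q" using Suc(2) unfolding pq by (subst (asm) degree_mult_eq) auto
  have rq: "\<And>w. poly q w = 0 \<Longrightarrow> Im w \<le> 0" using Suc.prems(2) by (simp add: pq)
  have ir: "Im (z - r) > 0" using Suc.prems(2)[OF r] assms(3) by simp
  then have "z \<noteq> r" by auto
  moreover have qz: "poly q z \<noteq> 0" using rq[of z] assms(3) by auto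
  ultimately have "poly (pderiv p) z / poly p z = 1 / (z - r) + poly (pderiv q) z / poly q z"
    unfolding pq pderiv_mult by (simp add: pderiv_pCons field_simps)
  moreover have "Im (1 / (z - r)) < 0" using ir by (rule Im_inverse_neg)
  \<comment> \<open>Only a weak bound, since \<open>q\<close> may be constant; strictness comes from
    the zero split off.\<close>
  moreover have "Im (poly (pderiv q) z / poly q z) \<le> 0"
  proof (cases "degree q = 0")
    case True
    then obtain a where "q = [:a:]" by (rule degree_eq_zeroE)
    then show ?thesis by (simp add: pderiv_pCons)
  next
    case False
    then show ?thesis using Suc(1)[OF dq _ rq] by simp
  qed
  ultimately show ?case by simp
qed simp

section \<open>Closure properties of hyperbolicity\<close>

lemma map_poly_of_real_pderiv:
  "map_poly complex_of_real (pderiv p) = pderiv (map_poly complex_of_real p)"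
  by (rule poly_eqI) (simp add: coeff_pderiv coeff_map_poly)

lemma map_poly_of_real_mult:
  "map_poly complex_of_real (p * q) = map_poly complex_of_real p * map_poly complex_of_real q"
  by (rule poly_eqI) (simp add: coeff_mult coeff_map_poly)

lemma map_poly_of_real_add:
  "map_poly complex_of_real (p + q) = map_poly complex_of_real p + map_poly complex_of_real q"
  by (rule poly_eqI) (simp add: coeff_map_poly)

lemma map_poly_of_real_smult:
  "map_poly complex_of_real (smult c p) = smult (of_real c) (map_poly complex_of_real p)"
  by (rule poly_eqI) (simp add: coeff_map_poly)

lemma poly_map_of_real_cnj:
  "poly (map_poly complex_of_real p) (cnj z) = cnj (poly (map_poly complex_of_real p) z)"
  by (induction p) (simp_all add: map_poly_pCons)

text \<open>Non-real zeros of a real polynomial come in conjugate pairs.\<close>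

lemma hyperbolicI:
  assumes "\<And>z. Im z > 0 \<Longrightarrow> poly (map_poly of_real p) z \<noteq> 0"
  shows "hyperbolic p"
  unfolding hyperbolic_def
proof (intro disjI2 allI impI)
  fix z :: complex
  assume 0: "poly (map_poly of_real p) z = 0"
  then have "poly (map_poly of_real p) (cnj z) = 0" by (simp add: poly_map_of_real_cnj)
  with 0 have "\<not> Im z > 0" "\<not> Im (cnj z) > 0" using assms by blast+
  then show "z \<in> \<real>" by (simp add: complex_is_Real_iff)
qed

lemma hyperbolic_const: "hyperbolic [:a:]"
  by (simp add: hyperbolic_def map_poly_pCons)

lemma hyperbolic_Im_root:
  assumes "hyperbolic p" "p \<noteq> 0" "poly (map_poly of_real p) z = 0"
  shows "Im z = 0"
  using assms by (auto simp: hyperbolic_def complex_is_Real_iff)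

lemma hyperbolic_mult:
  assumes "hyperbolic p" "hyperbolic q"
  shows "hyperbolic (p * q)"
  using assms by (auto simp: hyperbolic_def map_poly_of_real_mult)

lemma hyperbolic_power:
  assumes "hyperbolic p"
  shows "hyperbolic (p ^ n)"
  by (induction n) (use assms hyperbolic_const[of 1] in \<open>auto intro: hyperbolic_mult simp: one_pCons\<close>)

lemma hyperbolic_linear: "hyperbolic [:a, 1:]"
  by (rule hyperbolicI) (auto simp: map_poly_pCons complex_eq_iff)

lemma hyperbolic_pderiv:
  assumes "hyperbolic p"
  shows "hyperbolic (pderiv p)"
proof (cases "degree p = 0")
  case True
  then show ?thesis using hyperbolic_const[of 0] by (auto elim: degree_eq_zeroE simp: pderiv_pCons)
next
  case False
  then have "p \<noteq> 0" by auto
  show ?thesis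
  proof (rule hyperbolicI)
    fix z :: complex
    assume "Im z > 0"
    then have "Im (poly (pderiv (map_poly of_real p)) z / poly (map_poly of_real p) z) < 0"
      using False hyperbolic_Im_root[OF assms \<open>p \<noteq> 0\<close>]
      by (intro Im_logderiv_neg) (auto simp: degree_map_poly)
    then show "poly (map_poly of_real (pderiv p)) z \<noteq> 0"
      by (auto simp: map_poly_of_real_pderiv)
  qed
qed

lemma hyperbolic_funpow_pderiv:
  assumes "hyperbolic p"
  shows "hyperbolic ((pderiv ^^ n) p)"
  by (induction n) (use assms in \<open>auto intro: hyperbolic_pderiv\<close>)

section \<open>Half-plane estimates\<close>

lemma Im_le_uminus_iff_inverse:
  assumes "z \<noteq> 0"
  shows "Im z \<le> - t \<longleftrightarrow> t * (cmod (1 / z))\<^sup>2 \<le> Im (1 / z)"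
proof -
  have "(cmod z)\<^sup>2 > 0" using assms by simp
  then show ?thesis
    by (simp add: norm_divide power_divide Im_divide flip: cmod_power2) (simp add: divide_simps, linarith)
qed

text \<open>Inversion maps the half-plane \<open>Im z \<le> - t\<close> onto a disc, or a half-plane if \<open>t = 0\<close>,
  which is convex.\<close>

lemma Im_harmonic_mean_le:
  assumes "a \<noteq> 0" "b \<noteq> 0" "a + b \<noteq> 0" "t \<ge> 0" "Im a \<le> - t" "Im b \<le> - t"
  shows "Im (2 * a * b / (a + b)) \<le> - t"
proof -
  define x y where "x = 1 / a" and "y = 1 / b"
  have "t * (cmod x)\<^sup>2 \<le> Im x" "t * (cmod y)\<^sup>2 \<le> Im y"
    using assms Im_le_uminus_iff_inverse by (auto simp: x_def y_def)
  moreover have "(cmod ((x + y) / 2))\<^sup>2 \<le> ((cmod x)\<^sup>2 + (cmod y)\<^sup>2) / 2"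
  proof -
    have "(Re x + Re y)\<^sup>2 \<le> 2 * ((Re x)\<^sup>2 + (Re y)\<^sup>2)" "(Im x + Im y)\<^sup>2 \<le> 2 * ((Im x)\<^sup>2 + (Im y)\<^sup>2)"
      using sum_squares_bound[of "Re x" "Re y"] sum_squares_bound[of "Im x" "Im y"]
      by (simp_all add: power2_sum)
    then show ?thesis by (simp add: cmod_power2 norm_divide power_divide)
  qed
  then have "t * (cmod ((x + y) / 2))\<^sup>2 \<le> t * (((cmod x)\<^sup>2 + (cmod y)\<^sup>2) / 2)"
    using assms(4) by (rule mult_left_mono)
  ultimately have "t * (cmod ((x + y) / 2))\<^sup>2 \<le> Im ((x + y) / 2)"
    by (simp add: algebra_simps)
  \<comment> \<open>The harmonic mean of \<open>a\<close> and \<open>b\<close> is the inverse of the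
    midpoint of their inverses.\<close>
  moreover have "(x + y) / 2 = 1 / (2 * a * b / (a + b))"
    using assms by (simp add: x_def y_def field_simps)
  ultimately show ?thesis
    using assms by (subst Im_le_uminus_iff_inverse) auto
qed

text \<open>Used with \<open>u = G' / G\<close> at \<open>z\<close>, to control the part of the
  operator that the second Lieb--Sokal step leaves over.\<close>

lemma Im_symbol_quotient_nonpos:
  fixes m c :: real and z u :: complex
  assumes m: "m > 0" and c: "0 \<le> c" "c \<le> m\<^sup>2" and z: "Im z > 0" and u: "Im u \<le> 0"
  shows "Im ((c + m * z * u) / (m * z + (z\<^sup>2 - 1) * u)) \<le> 0"
proof -
  \<comment> \<open>Partial fractions: division by \<open>z\<^sup>2 - 1\<close> turns the
    denominator into a multiple of \<open>p + q + 2 * v\<close>, a sum of points of the closed lower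
    half-plane.\<close>
  define p q where "p = 1 / (z - 1)" and "q = 1 / (z + 1)"
  define v where "v = u / of_real m"
  have nz: "z - 1 \<noteq> 0" "z + 1 \<noteq> 0" using z by (auto simp: complex_eq_iff)
  have p: "Im p < 0" and q: "Im q < 0" using z Im_inverse_neg by (auto simp: p_def q_def)
  have v: "Im v \<le> 0" using u m by (simp add: v_def Im_divide_of_real divide_nonpos_pos)
  have uv: "u = m * v" using m by (simp add: v_def)
  have d: "p + q + 2 * v \<noteq> 0" using p q v by (auto simp: complex_eq_iff)
  have pq: "p + q = 2 * z / (z\<^sup>2 - 1)" "p * q = 1 / (z\<^sup>2 - 1)" and zz: "z\<^sup>2 - 1 \<noteq> 0"
  proof -
    have *: "z\<^sup>2 - 1 = (z - 1) * (z + 1)" by (simp add: power2_eq_square algebra_simps)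
    show "p + q = 2 * z / (z\<^sup>2 - 1)" "p * q = 1 / (z\<^sup>2 - 1)" "z\<^sup>2 - 1 \<noteq> 0"
      unfolding * p_def q_def using nz by (simp_all add: divide_simps)
  qed
  define l where "l = c / m\<^sup>2"
  have l: "0 \<le> l" "l \<le> 1" and cl: "c = l * m\<^sup>2" using c m by (auto simp: l_def)
  \<comment> \<open>The quotient is affine in \<open>c\<close>, so only \<open>c = 0\<close> and \<open>c = m\<^sup>2\<close> matter.\<close>
  define e0 where "e0 = (p + q) * v / (p + q + 2 * v)"
  define e1 where "e1 = (2 * p * q + (p + q) * v) / (p + q + 2 * v)"
  have "(c + m * z * u) / (m * z + (z\<^sup>2 - 1) * u) = of_real m * ((1 - of_real l) * e0 + of_real l * e1)"
  proof -
    have "(1 - of_real l) * e0 + of_real l * e1 = (2 * of_real l * (p * q) + (p + q) * v) / (p + q + 2 * v)"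
      unfolding e0_def e1_def by (simp add: divide_simps d) (simp add: algebra_simps)
    also have "\<dots> = (of_real l + z * v) / (z + (z\<^sup>2 - 1) * v)"
    proof -
      define w where "w = z\<^sup>2 - 1"
      have "2 * of_real l * (p * q) + (p + q) * v = 2 / (z\<^sup>2 - 1) * (of_real l + z * v)"
        "p + q + 2 * v = 2 / (z\<^sup>2 - 1) * (z + (z\<^sup>2 - 1) * v)"
        using zz unfolding pq w_def[symmetric] by (simp_all add: field_simps)
      moreover have "2 / (z\<^sup>2 - 1) \<noteq> 0" using zz by simp
      ultimately show ?thesis by (simp only:) (rule mult_divide_mult_cancel_left)
    qed
    finally have *: "(1 - of_real l) * e0 + of_real l * e1 = (of_real l + z * v) / (z + (z\<^sup>2 - 1) * v)" .
    have "c + m * z * u = of_real m * of_real m * (of_real l + z * v)"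
      "m * z + (z\<^sup>2 - 1) * u = of_real m * (z + (z\<^sup>2 - 1) * v)"
      by (simp_all add: cl uv power2_eq_square algebra_simps)
    then show ?thesis unfolding * using m by simp
  qed
  moreover have "Im e0 \<le> 0"
  proof (cases "v = 0")
    case False
    \<comment> \<open>\<open>4 * e0\<close> is the harmonic mean of \<open>p + q\<close> and
      \<open>2 * v\<close>.\<close>
    have "Im (2 * (p + q) * (2 * v) / ((p + q) + 2 * v)) \<le> - 0"
      by (rule Im_harmonic_mean_le) (use p q v d False in \<open>auto simp: complex_eq_iff\<close>)
    moreover have "2 * (p + q) * (2 * v) / ((p + q) + 2 * v) = of_real 4 * e0"
      unfolding e0_def by simp
    ultimately have "Im (of_real 4 * e0) \<le> 0" by simp
    then show ?thesis by (simp del: of_real_numeral)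
  qed (simp add: e0_def)
  moreover have "Im e1 \<le> 0"
  proof -
    \<comment> \<open>\<open>e1 + v\<close> is the harmonic mean of \<open>p + v\<close> and
      \<open>q + v\<close>, whose imaginary parts are at most \<open>Im v\<close>; hence the choice
      \<open>t = - Im v\<close>.\<close>
    have "Im (2 * (p + v) * (q + v) / ((p + v) + (q + v))) \<le> - (- Im v)"
      by (rule Im_harmonic_mean_le) (use p q v d in \<open>auto simp: complex_eq_iff\<close>)
    moreover have "2 * (p + v) * (q + v) / ((p + v) + (q + v)) = e1 + v"
      unfolding e1_def using d by (simp add: divide_simps) (simp add: algebra_simps)
    ultimately show ?thesis by simp
  qed
  ultimately show ?thesis
    using l m by (simp add: mult_le_0_iff add_nonpos_nonpos)
qed

section \<open>The operators \<open>M\<close>\<close>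

text \<open>For \<open>c = 0\<close> this is, up to sign, the differential part of Gegenbauer's
  equation with parameter \<open>m - 1/2\<close>.\<close>

definition gegenbauer_op :: "real \<Rightarrow> real \<Rightarrow> real poly \<Rightarrow> real poly" where
  "gegenbauer_op m c g = [:-1, 0, 1:] * pderiv (pderiv g) + [:0, 2 * m:] * pderiv g + smult c g"

lemma hyperbolic_gegenbauer_op:
  assumes m: "m > 0" and c: "0 \<le> c" "c \<le> m\<^sup>2" and g: "hyperbolic g"
  shows "hyperbolic (gegenbauer_op m c g)"
proof (cases "degree g = 0")
  case True
  then show ?thesis using hyperbolic_const
    by (auto elim!: degree_eq_zeroE simp: gegenbauer_op_def pderiv_pCons)
next
  case False
  then have "g \<noteq> 0" by auto
  define G where "G = map_poly complex_of_real g"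
  have dG: "degree G > 0" using False by (simp add: G_def degree_map_poly)
  have rG: "Im w \<le> 0" if "poly G w = 0" for w
    using hyperbolic_Im_root[OF g \<open>g \<noteq> 0\<close>] that by (simp add: G_def)
  show ?thesis
  proof (rule hyperbolicI)
    fix z :: complex
    assume z: "Im z > 0"
    have m0: "of_real m * z \<noteq> 0" using m z by auto
    \<comment> \<open>Two Lieb--Sokal steps in \<open>x\<close>, the coefficients of the operator being frozen at \<open>z\<close>.\<close>
    have Gx: "poly G x \<noteq> 0" if "Im x > 0" for x using rG[of x] that by auto
    \<comment> \<open>As \<open>z\<close> is constant here, the operator applied to \<open>g\<close>
      is, at \<open>z\<close>, \<open>Q'\<close> plus \<open>c G + m z G'\<close>. After division by
      \<open>Q\<close>, both summands are estimated separately.\<close>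
    define Q where "Q = smult (of_real m * z) G + smult (z\<^sup>2 - 1) (pderiv G)"
    have Q: "poly Q x = poly G x * (m * z + (z\<^sup>2 - 1) * (poly (pderiv G) x / poly G x))"
      if "Im x > 0" for x
    proof -
      define u where "u = poly (pderiv G) x / poly G x"
      have "poly (pderiv G) x = u * poly G x" using Gx[OF that] by (simp add: u_def)
      then show ?thesis unfolding u_def[symmetric] by (simp add: Q_def algebra_simps)
    qed
    have ld: "Im (poly (pderiv G) x / poly G x) < 0" if "Im x > 0" for x
      using dG rG that by (rule Im_logderiv_neg)
    \<comment> \<open>At a zero of \<open>Q\<close>, \<open>G' / G\<close> would be
      \<open>- m z / (z\<^sup>2 - 1)\<close>, which has positive imaginary part by partial
      fractions.\<close>
    have "poly Q x \<noteq> 0" if x: "Im x > 0" for x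
    proof
      assume "poly Q x = 0"
      then have 0: "m * z + (z\<^sup>2 - 1) * (poly (pderiv G) x / poly G x) = 0"
        using Q[OF x] Gx[OF x] by simp
      have nz: "z - 1 \<noteq> 0" "z + 1 \<noteq> 0" using z by (auto simp: complex_eq_iff)
      have *: "z\<^sup>2 - 1 = (z - 1) * (z + 1)" by (simp add: power2_eq_square algebra_simps)
      have "z\<^sup>2 - 1 \<noteq> 0" unfolding * using nz by simp
      then have "poly (pderiv G) x / poly G x = ((z\<^sup>2 - 1) * (poly (pderiv G) x / poly G x)) / (z\<^sup>2 - 1)"
        by simp
      also have "(z\<^sup>2 - 1) * (poly (pderiv G) x / poly G x) = - (m * z)"
        using 0 by (simp only: eq_neg_iff_add_eq_0 add.commute)
      also have "- (m * z) / (z\<^sup>2 - 1) = - (m * z / (z\<^sup>2 - 1))"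
        by (rule minus_divide_left[symmetric])
      also have "m * z / (z\<^sup>2 - 1) = of_real (m / 2) * (1 / (z - 1) + 1 / (z + 1))"
        unfolding * using nz by (simp add: divide_simps)
      finally have "poly (pderiv G) x / poly G x = - (of_real (m / 2) * (1 / (z - 1) + 1 / (z + 1)))" .
      moreover have "Im (1 / (z - 1) + 1 / (z + 1)) < 0"
        using Im_inverse_neg[of "z - 1"] Im_inverse_neg[of "z + 1"] z by simp
      then have "Im (of_real (m / 2) * (1 / (z - 1) + 1 / (z + 1))) < 0"
        using m by (simp only: Im_complex_of_real times_complex.sel Re_complex_of_real)
          (simp add: mult_less_0_iff)
      ultimately show False using ld[OF x] by simp
    qed
    then have rQ: "Im x \<le> 0" if "poly Q x = 0" for x using that not_le by blast
    \<comment> \<open>\<open>Q\<close> must be nonconstant for its logarithmic derivative to have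
      strictly negative imaginary part.\<close>
    have "degree (smult (z\<^sup>2 - 1) (pderiv G)) < degree (smult (of_real m * z) G)"
      using dG m0 by (intro le_less_trans[OF degree_smult_le]) (simp add: degree_pderiv)
    then have "degree Q = degree G" using m0 by (simp add: Q_def degree_add_eq_left)
    then have "Im (poly (pderiv Q) z / poly Q z) < 0"
      using dG rQ z by (intro Im_logderiv_neg) auto
    moreover have "Im ((c * poly G z + m * z * poly (pderiv G) z) / poly Q z) \<le> 0"
    proof -
      have "c * poly G z + m * z * poly (pderiv G) z
        = poly G z * (c + m * z * (poly (pderiv G) z / poly G z))"
        using Gx[OF z] by (simp add: field_simps)
      then show ?thesis
        using Im_symbol_quotient_nonpos[OF m c z, of "poly (pderiv G) z / poly G z"] ld[OF z] Gx[OF z]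
        by (simp add: Q[OF z])
    qed
    moreover have "poly (map_poly of_real (gegenbauer_op m c g)) z
      = (c * poly G z + m * z * poly (pderiv G) z) + poly (pderiv Q) z"
      unfolding gegenbauer_op_def map_poly_of_real_add map_poly_of_real_mult
        map_poly_of_real_smult map_poly_of_real_pderiv Q_def G_def[symmetric]
      by (simp add: map_poly_pCons pderiv_add pderiv_smult algebra_simps power2_eq_square)
    ultimately have "Im (poly (map_poly of_real (gegenbauer_op m c g)) z / poly Q z) < 0"
      by (simp only: add_divide_distrib plus_complex.sel)
    then show "poly (map_poly of_real (gegenbauer_op m c g)) z \<noteq> 0"
      by auto
  qed
qed

lemma hyperbolic_fold_gegenbauer_op:
  assumes "m > 0" "\<forall>c \<in> set cs. 0 \<le> c \<and> c \<le> m\<^sup>2" "hyperbolic g"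
  shows "hyperbolic (fold (gegenbauer_op m) cs g)"
  using assms by (induction cs arbitrary: g) (auto intro: hyperbolic_gegenbauer_op)

section \<open>Action on Legendre polynomials\<close>

text \<open>Differentiate Legendre's equation \<open>n\<close> times: the step from \<open>n\<close>
  to \<open>n + 1\<close> adds \<open>2 x\<close> to the first-order coefficient and subtracts
  \<open>2 (n + 1)\<close> from the eigenvalue.\<close>

lemma gegenbauer_op_eigen:
  assumes "is_legendre k y"
  shows "gegenbauer_op (real n + 1) c ((pderiv ^^ n) y)
    = smult (real k * (real k + 1) - real n * (real n + 1) + c) ((pderiv ^^ n) y)"
proof -
  define g where "g n = (pderiv ^^ n) y" for n
  have "[:-1, 0, 1:] * g (Suc (Suc n)) + [:0, 2 * (real n + 1):] * g (Suc n)
    = smult (real k * (real k + 1) - real n * (real n + 1)) (g n)"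
  proof (induction n)
    case 0
    then show ?case using assms by (simp add: is_legendre_def g_def)
  next
    case (Suc n)
    have s: "pderiv (g n) = g (Suc n)" for n by (simp add: g_def)
    have "pderiv ([:-1, 0, 1:] * g (Suc (Suc n)) + [:0, 2 * (real n + 1):] * g (Suc n))
      = smult (real k * (real k + 1) - real n * (real n + 1)) (g (Suc n))"
      unfolding Suc by (simp add: pderiv_smult s)
    moreover have "pderiv ([:-1, 0, 1:] * g (Suc (Suc n)) + [:0, 2 * (real n + 1):] * g (Suc n))
      = [:-1, 0, 1:] * g (Suc (Suc (Suc n))) + [:0, 2 * (real (Suc n) + 1):] * g (Suc (Suc n))
        + smult (2 * (real n + 1)) (g (Suc n))"
    proof -
      have d: "pderiv [:-1, 0, 1:] = [:0, 2 :: real:]" "pderiv [:0, a:] = [:a:]" for a :: real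
        by (simp_all add: pderiv_pCons)
      have "[:0, 2 * (real (Suc n) + 1):] = [:0, 2:] + [:0, 2 * (real n + 1):]" by simp
      then show ?thesis
        unfolding pderiv_add pderiv_mult s d by (simp only: distrib_right distrib_left) simp
    qed
    ultimately have "[:-1, 0, 1:] * g (Suc (Suc (Suc n))) + [:0, 2 * (real (Suc n) + 1):] * g (Suc (Suc n))
      = smult (real k * (real k + 1) - real n * (real n + 1)) (g (Suc n))
        - smult (2 * (real n + 1)) (g (Suc n))"
      by (simp only: eq_diff_eq)
    moreover have "real k * (real k + 1) - real (Suc n) * (real (Suc n) + 1)
      = real k * (real k + 1) - real n * (real n + 1) - 2 * (real n + 1)" by (simp add: algebra_simps)
    ultimately show ?case by (simp only: smult_diff_left)
  qed
  then show ?thesis by (simp add: gegenbauer_op_def g_def smult_add_left)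
qed

lemma funpow_pderiv_smult: "(pderiv ^^ n) (smult a p) = smult a ((pderiv ^^ n) p)"
  by (induction n) (simp_all add: pderiv_smult)

text \<open>The innermost of the outer derivatives turns \<open>(x\<^sup>2 -
  1)\<^sup>n\<^sup>+\<^sup>1 D\<^sup>n\<^sup>+\<^sup>1 y\<close> into
  \<open>(x\<^sup>2 - 1)\<^sup>n\<close> times a Gegenbauer operator on \<open>D\<^sup>n y\<close>;
  its eigenvalue is the new factor.\<close>

lemma pderiv_power_pderiv_eigen:
  assumes "is_legendre k y"
  shows "(pderiv ^^ n) ([:-1, 0, 1:] ^ n * (pderiv ^^ n) y)
    = smult (\<Prod>i<n. real k * (real k + 1) - real i * (real i + 1)) y"
proof (induction n)
  case (Suc n)
  define g where "g = (pderiv ^^ n) y"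
  have "pderiv ([:-1, 0, 1:] ^ Suc n * pderiv g)
    = [:-1, 0, 1:] ^ n * ([:-1, 0, 1:] * pderiv (pderiv g) + [:0, 2 * (real n + 1):] * pderiv g)"
  proof -
    have "pderiv ([:-1, 0, 1:] ^ Suc n) = [:-1, 0, 1:] ^ n * [:0, 2 * (real n + 1):]"
      unfolding pderiv_power_Suc by (simp add: pderiv_pCons add.commute)
    then show ?thesis unfolding pderiv_mult by (simp add: algebra_simps)
  qed
  also have "\<dots> = smult (real k * (real k + 1) - real n * (real n + 1)) ([:-1, 0, 1:] ^ n * g)"
    using gegenbauer_op_eigen[OF assms, of n 0] by (simp add: gegenbauer_op_def g_def)
  finally have "(pderiv ^^ Suc n) ([:-1, 0, 1:] ^ Suc n * (pderiv ^^ Suc n) y)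
    = (pderiv ^^ n) (smult (real k * (real k + 1) - real n * (real n + 1)) ([:-1, 0, 1:] ^ n * g))"
    by (simp add: funpow_Suc_right g_def del: funpow.simps power_Suc) (simp add: funpow_swap1)
  also have "\<dots> = smult (real k * (real k + 1) - real n * (real n + 1))
      ((pderiv ^^ n) ([:-1, 0, 1:] ^ n * g))"
    by (rule funpow_pderiv_smult)
  finally show ?case using Suc by (simp add: g_def mult.commute)
qed simp

theorem corollary3:
  fixes n N :: nat and A :: "nat \<Rightarrow> real" and h :: "real poly"
  assumes "n \<ge> 1" and "N \<ge> 1"
    and "\<And>j. j \<in> {1..N} \<Longrightarrow> - (real n + 1) \<le> A j \<and> A j \<le> real n * (real n + 1)"
    and "h = (\<Prod>i<n. [:- (real i * (real i + 1)), 1:]) * (\<Prod>j=1..N. [:- A j, 1:])"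
  shows "legendre_multiplier_sequence (\<lambda>k. poly h (real k ^ 2 + real k))"
proof -
  define cs where "cs = map (\<lambda>j. real n * (real n + 1) - A j) [1..<Suc N]"
  define S where "S = fold (gegenbauer_op (real n + 1)) cs"
  define T where "T f = (pderiv ^^ n) ([:-1, 0, 1:] ^ n * S ((pderiv ^^ n) f))" for f
  show ?thesis
    unfolding legendre_multiplier_sequence_def
  proof (intro exI conjI allI)
    have D_add: "(pderiv ^^ n) (f + g) = (pderiv ^^ n) f + (pderiv ^^ n) g" for f g :: "real poly"
      by (induction n) (simp_all add: pderiv_add)
    have "gegenbauer_op m c (f + g) = gegenbauer_op m c f + gegenbauer_op m c g" for m c f g
      by (simp add: gegenbauer_op_def pderiv_add algebra_simps smult_add_right)
    then have S_add: "S (f + g) = S f + S g" for f g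
      unfolding S_def by (induction cs arbitrary: f g) simp_all
    have op_smult: "gegenbauer_op m c (smult a f) = smult a (gegenbauer_op m c f)" for m c a f
      by (simp add: gegenbauer_op_def pderiv_smult smult_add_right smult_diff_right mult.commute)
    then have S_smult: "S (smult a f) = smult a (S f)" for a f
      unfolding S_def by (induction cs arbitrary: f) simp_all
    show "Vector_Spaces.linear smult smult T"
      by unfold_locales
        (simp_all add: T_def D_add funpow_pderiv_smult S_add S_smult distrib_left smult_add_right smult_add_left)
    show "T (legendre k) = smult (poly h (real k ^ 2 + real k)) (legendre k)" for k
    proof -
      note y = is_legendre_legendre[of k]
      define \<mu> where "\<mu> = real k * (real k + 1)"
      have \<mu>: "real k ^ 2 + real k = \<mu>" by (simp add: \<mu>_def power2_eq_square algebra_simps)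
      \<comment> \<open>The free scalar \<open>a\<close> accumulates the eigenvalues, as
        \<open>fold\<close> applies the head of the list first.\<close>
      have "fold (gegenbauer_op (real n + 1)) cs (smult a ((pderiv ^^ n) (legendre k)))
        = smult (a * (\<Prod>c\<leftarrow>cs. \<mu> - real n * (real n + 1) + c)) ((pderiv ^^ n) (legendre k))" for cs a
        by (induction cs arbitrary: a)
          (simp_all add: op_smult gegenbauer_op_eigen[OF y] \<mu>_def mult.assoc)
      from this[of cs 1] have "S ((pderiv ^^ n) (legendre k))
        = smult (\<Prod>c\<leftarrow>cs. \<mu> - real n * (real n + 1) + c) ((pderiv ^^ n) (legendre k))"
        by (simp add: S_def)
      also have "(\<Prod>c\<leftarrow>cs. \<mu> - real n * (real n + 1) + c) = (\<Prod>j=1..N. \<mu> - A j)"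
        using prod.distinct_set_conv_list[of "[1..<Suc N]" "\<lambda>j. \<mu> - A j"]
        by (simp add: cs_def o_def atLeastLessThanSuc_atLeastAtMost del: upt_Suc)
      finally have "T (legendre k) = smult ((\<Prod>j=1..N. \<mu> - A j) * (\<Prod>i<n. \<mu> - real i * (real i + 1))) (legendre k)"
        using pderiv_power_pderiv_eigen[OF y, of n] by (simp add: T_def funpow_pderiv_smult \<mu>_def)
      then show ?thesis
        by (simp add: \<mu> assms(4) poly_prod mult.commute)
    qed
    show "hyperbolicity_preserver T"
      unfolding hyperbolicity_preserver_def
    proof (intro allI impI)
      fix p assume "hyperbolic p"
      \<comment> \<open>The lower bound on \<open>A j\<close> gives
        \<open>c \<le> n (n + 1) + (n + 1) = (n + 1)\<^sup>2\<close>, the upper one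
        \<open>c \<ge> 0\<close>.\<close>
      moreover have "\<forall>c \<in> set cs. 0 \<le> c \<and> c \<le> (real n + 1)\<^sup>2"
        using assms(3) by (fastforce simp: cs_def power2_eq_square algebra_simps)
      ultimately have "hyperbolic (S ((pderiv ^^ n) p))"
        unfolding S_def by (intro hyperbolic_fold_gegenbauer_op hyperbolic_funpow_pderiv) auto
      moreover have "[:-1, 0, 1:] = [:-1, 1:] * [:1, 1 :: real:]" by simp
      then have "hyperbolic [:-1, 0, 1:]" using hyperbolic_mult hyperbolic_linear by metis
      ultimately show "hyperbolic (T p)"
        unfolding T_def by (intro hyperbolic_funpow_pderiv hyperbolic_mult hyperbolic_power)
    qed
  qed
qed

end
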